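(* Let $1<p<\infty$. For all $\alpha>0$, $$\sum_{k\in\mathbb{Z}}\nu_k^\alpha\le 28\biggl(\frac{8}{\beta_p}\biggr)^\alpha\sum_{n\in\mathbb{N}}a_n^\alpha(\mathcal{H}).$$
   Context: $\mathbb{R}^+=[0,+\infty)$, $\mathbb{N}=\{1,2,\ldots\}$, $1<p<\infty$, $p'=p/(p-1)$. Products $0\cdot\infty$ are taken to be $0$. $v,w$ are non-negative weight functions on $\mathbb{R}^+$ with $v\in L^{p'}_{\rm loc}(0,\infty)$ and $w\in L^p_{\rm loc}(0,\infty)$. The boundary functions $a(x),b(x)$ satisfy: (i) $a,b$ are differentiable and strictly increasing on $(0,\infty)$; (ii) $a(0)=b(0)=0$, $a(x)<b(x)$ for $0<x<\infty$, $a(\infty)=b(\infty)=\infty$. The Hardy-Steklov operator on $L^p(\mathbb{R}^+)$ is $$\mathcal{H}f(x)=w(x)\int_{a(x)}^{b(x)}f(y)v(y)\,\mathrm{d}y.$$ The approximation numbers of $T:X\to X$ are $a_n(T)=\inf_{K:\,\mathrm{rank}\,K<n}\|T-K\|_{X\to X}$, $n=1,2,\ldots$; here $X=L^p(\mathbb{R}^+)$. The sequence $\{\xi_k\}_{k\in\mathbb{Z}}\subset(0,\infty)$ is defined by $\xi_0=1$, $\xi_k=(a^{-1}\circ b)^k(1)$, $k\in\mathbb{Z}$. The fairway function $\sigma$ satisfies $a(t)<\sigma(t)<b(t)$ and $\int_{a(t)}^{\sigma(t)}v^{p'}(y)\,\mathrm{d}y=\int_{\sigma(t)}^{b(t)}v^{p'}(y)\,\mathrm{d}y$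 for all $t>0$. For $k\in\mathbb{Z}$, $$\nu_k:=\sup_{t\in(\xi_k,\xi_{k+1})}\biggl(\int_{b^{-1}(\sigma(t))}^{a^{-1}(\sigma(t))}w^p(x)\,\mathrm{d}x\biggr)^{1/p}\biggl(\int_{a(t)}^{b(t)}v^{p'}(y)\,\mathrm{d}y\biggr)^{1/p'}.$$ $\beta_p>0$ is the constant, depending only on $p$, in the known lower norm estimate $\beta_p\sup_{k\in\mathbb{Z}}\nu_k\le\|\mathcal{H}\|_{L^p\to L^p}$ (valid for all non-negative weights $v\in L^{p'}_{\rm loc}(0,\infty)$, $w\in L^p_{\rm loc}(0,\infty)$ and all functions $a,b$ that are differentiable and strictly increasing on $(0,\infty)$ with $a(0)=b(0)=0$, $a(x)<b(x)$ for $0<x<\infty$, $a(\infty)=b(\infty)=\infty$). *)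

theory Defs
  imports "HOL-Analysis.Analysis"
begin

section \<open>Real functions on the half-line modulo equality almost everywhere\<close>

abbreviation half_line :: "real measure" where
  "half_line \<equiv> lebesgue_on {0..}"

text \<open>
  The type consists of classes of arbitrary real functions, so that it does not depend on an
  exponent and integral operators are total on it; measurability is demanded in
  \<open>Lp\<close> below.  Values at negative arguments are irrelevant.
\<close>

quotient_type ae_fun = "real \<Rightarrow> real" / "\<lambda>f g. AE x in half_line. f x = g x"
  by (rule equivpI) (auto simp: reflp_def symp_def transp_def)

instantiation ae_fun :: real_vector
begin

lift_definition zero_ae_fun :: ae_fun is "\<lambda>_. 0" .

lift_definition plus_ae_fun :: "ae_fun \<Rightarrow> ae_fun \<Rightarrow> ae_fun" is "\<lambda>f g x. f x + g x"
  by (elim AE_mp) auto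

lift_definition minus_ae_fun :: "ae_fun \<Rightarrow> ae_fun \<Rightarrow> ae_fun" is "\<lambda>f g x. f x - g x"
  by (elim AE_mp) auto

lift_definition uminus_ae_fun :: "ae_fun \<Rightarrow> ae_fun" is "\<lambda>f x. - f x"
  by (elim AE_mp) auto

lift_definition scaleR_ae_fun :: "real \<Rightarrow> ae_fun \<Rightarrow> ae_fun" is "\<lambda>c f x. c * f x"
  by (elim AE_mp) auto

instance
  by standard (transfer; simp add: algebra_simps)+

end

lemma half_line_measurable_AE:
  fixes f g :: "real \<Rightarrow> real"
  assumes f: "f \<in> borel_measurable half_line" and ae: "AE x in half_line. f x = g x"
  shows "g \<in> borel_measurable half_line"
proof -
  have "AE x in lebesgue. x \<in> {0..} \<longrightarrow> f x = g x"
    using ae by (subst (asm) AE_restrict_space_iff) auto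
  then have ae': "AE x in lebesgue. (if x \<in> {0..} then f x else 0) = (if x \<in> {0..} then g x else 0)"
    by (elim AE_mp) auto
  have "(\<lambda>x. if x \<in> {0..} then f x else 0) \<in> borel_measurable lebesgue"
    using f by (subst borel_measurable_if) simp_all
  then have "(\<lambda>x. if x \<in> {0..} then g x else 0) \<in> borel_measurable lebesgue"
    by (rule borel_measurable_AE[OF _ ae'])
  then show ?thesis
    by (subst (asm) borel_measurable_if) simp_all
qed

lemma half_line_integral_cong_AE:
  fixes f g :: "real \<Rightarrow> real"
  assumes ae: "AE x in half_line. f x = g x"
  shows "(LINT x|half_line. f x) = (LINT x|half_line. g x)"
proof (cases "f \<in> borel_measurable half_line")
  case True
  then show ?thesis
    using half_line_measurable_AE[OF True ae] ae by (intro integral_cong_AE)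
next
  case False
  have "AE x in half_line. g x = f x"
    using ae by (elim AE_mp) auto
  with False have "g \<notin> borel_measurable half_line"
    using half_line_measurable_AE by blast
  with False have "\<not> integrable half_line f" "\<not> integrable half_line g"
    using borel_measurable_integrable by blast+
  then show ?thesis
    by (simp add: not_integrable_integral_eq)
qed

section \<open>Lebesgue spaces, operators and approximation numbers\<close>

text \<open>
  Powers of extended non-negative numbers with exponent \<open>r > 0\<close>, so that the power of
  \<open>\<infinity>\<close> is \<open>\<infinity>\<close>.
\<close>

definition enn_powr :: "ennreal \<Rightarrow> real \<Rightarrow> ennreal" where
  "enn_powr x r = (if x = \<infinity> then \<infinity> else ennreal (enn2real x powr r))"

lift_definition ae_measurable :: "ae_fun \<Rightarrow> bool" is "\<lambda>f. f \<in> borel_measurable half_line"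
proof -
  fix f g :: "real \<Rightarrow> real"
  assume ae: "AE x in half_line. f x = g x"
  then have "AE x in half_line. g x = f x"
    by (elim AE_mp) auto
  with ae show "f \<in> borel_measurable half_line \<longleftrightarrow> g \<in> borel_measurable half_line"
    using half_line_measurable_AE by blast
qed

lift_definition Lp_norm :: "real \<Rightarrow> ae_fun \<Rightarrow> ennreal" is
  "\<lambda>p f. enn_powr (\<integral>\<^sup>+x. ennreal (\<bar>f x\<bar> powr p) \<partial>half_line) (1 / p)"
proof -
  fix p :: real and f g :: "real \<Rightarrow> real"
  assume "AE x in half_line. f x = g x"
  then have "AE x in half_line. ennreal (\<bar>f x\<bar> powr p) = ennreal (\<bar>g x\<bar> powr p)"
    by (elim AE_mp) auto
  then have "(\<integral>\<^sup>+x. ennreal (\<bar>f x\<bar> powr p) \<partial>half_line) = (\<integral>\<^sup>+x. ennreal (\<bar>g x\<bar> powr p) \<partial>half_line)"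
    by (rule nn_integral_cong_AE)
  then show "enn_powr (\<integral>\<^sup>+x. ennreal (\<bar>f x\<bar> powr p) \<partial>half_line) (1 / p)
           = enn_powr (\<integral>\<^sup>+x. ennreal (\<bar>g x\<bar> powr p) \<partial>half_line) (1 / p)"
    by simp
qed

definition Lp :: "real \<Rightarrow> ae_fun set" where
  "Lp p = {F. ae_measurable F \<and> Lp_norm p F < \<infinity>}"

definition operator_norm :: "real \<Rightarrow> (ae_fun \<Rightarrow> ae_fun) \<Rightarrow> ennreal" where
  "operator_norm p T = (SUP F\<in>{F \<in> Lp p. Lp_norm p F \<le> 1}. Lp_norm p (T F))"

definition bounded_operator :: "real \<Rightarrow> (ae_fun \<Rightarrow> ae_fun) \<Rightarrow> bool" where
  "bounded_operator p K \<longleftrightarrow>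
     K ` Lp p \<subseteq> Lp p \<and>
     (\<forall>F\<in>Lp p. \<forall>G\<in>Lp p. K (F + G) = K F + K G) \<and>
     (\<forall>c. \<forall>F\<in>Lp p. K (c *\<^sub>R F) = c *\<^sub>R K F) \<and>
     operator_norm p K < \<infinity>"

text \<open>
  Since \<open>dim\<close> is \<open>0\<close> on infinite-dimensional spaces, finite dimension of the
  range is a separate conjunct.
\<close>

definition rank_less :: "real \<Rightarrow> (ae_fun \<Rightarrow> ae_fun) \<Rightarrow> nat \<Rightarrow> bool" where
  "rank_less p K n \<longleftrightarrow>
     (\<exists>B. finite B \<and> K ` Lp p \<subseteq> span B) \<and> dim (K ` Lp p) < n"

text \<open>
  All approximation numbers of an operator that is not bounded on \<open>Lp p\<close> are \<open>\<infinity>\<close>.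
\<close>

definition approx_number :: "real \<Rightarrow> (ae_fun \<Rightarrow> ae_fun) \<Rightarrow> nat \<Rightarrow> ennreal" where
  "approx_number p T n =
     (INF K\<in>{K. bounded_operator p K \<and> rank_less p K n}. operator_norm p (\<lambda>F. T F - K F))"

section \<open>The Hardy-Steklov operator\<close>

definition conj_exponent :: "real \<Rightarrow> real" where
  "conj_exponent p = p / (p - 1)"

definition Lp_loc :: "real \<Rightarrow> (real \<Rightarrow> real) \<Rightarrow> bool" where
  "Lp_loc q u \<longleftrightarrow>
     u \<in> borel_measurable (lebesgue_on {0<..}) \<and>
     (\<forall>C. compact C \<and> C \<subseteq> {0<..} \<longrightarrow> (\<integral>\<^sup>+x\<in>C. ennreal (\<bar>u x\<bar> powr q) \<partial>lebesgue) < \<infinity>)"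

definition weights :: "real \<Rightarrow> (real \<Rightarrow> real) \<Rightarrow> (real \<Rightarrow> real) \<Rightarrow> bool" where
  "weights p v w \<longleftrightarrow>
     (\<forall>x\<ge>0. 0 \<le> v x) \<and> (\<forall>x\<ge>0. 0 \<le> w x) \<and> Lp_loc (conj_exponent p) v \<and> Lp_loc p w"

text \<open>
  The requirements \<open>a(0) = b(0) = 0\<close> are read as including continuity at \<open>0\<close>; this is what
  makes \<open>a\<close> and \<open>b\<close> bijections of the open half-line, whose inverses are used below.
\<close>

definition boundary_functions :: "(real \<Rightarrow> real) \<Rightarrow> (real \<Rightarrow> real) \<Rightarrow> bool" where
  "boundary_functions a b \<longleftrightarrow>
     a differentiable_on {0<..} \<and> b differentiable_on {0<..} \<and>
     strict_mono_on {0<..} a \<and> strict_mono_on {0<..} b \<and>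
     a 0 = 0 \<and> b 0 = 0 \<and> (a \<longlongrightarrow> 0) (at_right 0) \<and> (b \<longlongrightarrow> 0) (at_right 0) \<and>
     (\<forall>x>0. a x < b x) \<and>
     filterlim a at_top at_top \<and> filterlim b at_top at_top"

lift_definition hardy_steklov ::
    "(real \<Rightarrow> real) \<Rightarrow> (real \<Rightarrow> real) \<Rightarrow> (real \<Rightarrow> real) \<Rightarrow> (real \<Rightarrow> real) \<Rightarrow> ae_fun \<Rightarrow> ae_fun" is
  "\<lambda>v w a b f x. w x * (LINT y:{a x..b x}|half_line. f y * v y)"
proof -
  fix v w a b f g :: "real \<Rightarrow> real"
  assume ae: "AE x in half_line. f x = g x"
  have "(LINT y:S|half_line. f y * v y) = (LINT y:S|half_line. g y * v y)" for S
    unfolding set_lebesgue_integral_def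
    by (rule half_line_integral_cong_AE) (use ae in \<open>elim AE_mp, auto\<close>)
  then show "AE x in half_line. w x * (LINT y:{a x..b x}|half_line. f y * v y)
                              = w x * (LINT y:{a x..b x}|half_line. g y * v y)"
    by simp
qed

abbreviation pos_inv :: "(real \<Rightarrow> real) \<Rightarrow> real \<Rightarrow> real" where
  "pos_inv f \<equiv> the_inv_into {0<..} f"

definition xi :: "(real \<Rightarrow> real) \<Rightarrow> (real \<Rightarrow> real) \<Rightarrow> int \<Rightarrow> real" where
  "xi a b k =
     (let g = pos_inv a \<circ> b
      in if 0 \<le> k then (g ^^ nat k) 1 else (pos_inv g ^^ nat (- k)) 1)"

definition power_mass :: "real \<Rightarrow> (real \<Rightarrow> real) \<Rightarrow> real \<Rightarrow> real \<Rightarrow> ennreal" where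
  "power_mass q u c d = (\<integral>\<^sup>+y\<in>{c..d}. ennreal (u y powr q) \<partial>lebesgue)"

definition fairway ::
    "real \<Rightarrow> (real \<Rightarrow> real) \<Rightarrow> (real \<Rightarrow> real) \<Rightarrow> (real \<Rightarrow> real) \<Rightarrow> (real \<Rightarrow> real) \<Rightarrow> bool" where
  "fairway p v a b \<sigma> \<longleftrightarrow>
     (\<forall>t>0. a t < \<sigma> t \<and> \<sigma> t < b t \<and>
        power_mass (conj_exponent p) v (a t) (\<sigma> t) = power_mass (conj_exponent p) v (\<sigma> t) (b t))"

definition nu ::
    "real \<Rightarrow> (real \<Rightarrow> real) \<Rightarrow> (real \<Rightarrow> real) \<Rightarrow> (real \<Rightarrow> real) \<Rightarrow> (real \<Rightarrow> real) \<Rightarrow> (real \<Rightarrow> real)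
      \<Rightarrow> int \<Rightarrow> ennreal" where
  "nu p v w a b \<sigma> k =
     (SUP t\<in>{xi a b k<..<xi a b (k + 1)}.
        enn_powr (power_mass p w (pos_inv b (\<sigma> t)) (pos_inv a (\<sigma> t))) (1 / p) *
        enn_powr (power_mass (conj_exponent p) v (a t) (b t)) (1 / conj_exponent p))"

text \<open>
  \<open>\<beta>\<close> is admissible in the lower norm estimate for the exponent \<open>p\<close>.  The norm is
  \<open>\<infinity>\<close> when the operator is not bounded on \<open>Lp p\<close>.
\<close>

definition lower_norm_constant :: "real \<Rightarrow> real \<Rightarrow> bool" where
  "lower_norm_constant p \<beta> \<longleftrightarrow>
     0 < \<beta> \<and>
     (\<forall>v w a b \<sigma>. weights p v w \<and> boundary_functions a b \<and> fairway p v a b \<sigma> \<longrightarrow>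
        ennreal \<beta> * (SUP k. nu p v w a b \<sigma> k) \<le> operator_norm p (hardy_steklov v w a b))"

end

theory Submission
  imports Defs
begin

text \<open>
  Since \<open>a(\<xi>\<^bsub>k+1\<^esub>) = b(\<xi>\<^bsub>k\<^esub>)\<close>, the number \<open>\<nu>\<^bsub>k\<^esub>\<close> sees the weight \<open>w\<close> only on
  the window \<open>(\<xi>\<^bsub>k-1\<^esub>, \<xi>\<^bsub>k+2\<^esub>)\<close> (\<open>nu_localized\<close>).  The lower norm estimate, applied to
  \<open>w\<close> restricted to that window, with \<open>v\<close> and hence the fairway unchanged, therefore says
  that \<open>\<beta> \<nu>\<^bsub>k\<^esub>\<close> is at most the norm of the operator with its output cut off to the window.  That
  windowed operator uses the input only on \<open>(a(\<xi>\<^bsub>k-1\<^esub>), b(\<xi>\<^bsub>k+2\<^esub>))\<close>, and the right end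
  \<open>b(\<xi>\<^bsub>k+2\<^esub>) = a(\<xi>\<^bsub>k+3\<^esub>)\<close> is where the input interval for \<open>k + 4\<close> begins.  So for indices
  in one residue class modulo \<open>4\<close> the pieces act independently, like a block-diagonal operator.

  For \<open>n\<close> such indices, choose near-extremal functions of the pieces with disjoint supports.
  An operator of rank less than \<open>n\<close> vanishes on some nontrivial combination of them, while the
  Hardy-Steklov operator multiplies the \<open>\<ell>\<^sup>p\<close> norm of the coefficients at least by any given
  number below all of the \<open>\<beta> \<nu>\<^bsub>k\<^esub>\<close> (\<open>approx_number_ge\<close>, \<open>approx_number_hardy_steklov_ge\<close>).  Thus the
  \<open>n\<close>-th approximation number is at least the \<open>n\<close>-th largest \<open>\<beta> \<nu>\<^bsub>k\<^esub>\<close> of the class.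
  Summing powers over each class (\<open>sum_le_sum_if_subset_min_le\<close>) and then over the four classes
  gives the inequality with \<open>4 \<beta>\<^sup>-\<^sup>\<alpha>\<close>, which is at most the stated constant.
\<close>

section \<open>Powers of extended non-negative numbers\<close>

lemma enn_powr_ennreal: "0 \<le> x \<Longrightarrow> enn_powr (ennreal x) r = ennreal (x powr r)"
  by (simp add: enn_powr_def)

lemma enn_powr_mono:
  assumes "x \<le> y" "0 \<le> r"
  shows "enn_powr x r \<le> enn_powr y r"
proof (cases y)
  case (real t)
  with assms obtain u where "x = ennreal u" "0 \<le> u" "u \<le> t"
    by (metis ennreal_cases ennreal_le_iff ennreal_less_top leD top.not_eq_extremum)
  with real assms show ?thesis
    by (auto simp: enn_powr_ennreal intro!: ennreal_leI powr_mono2)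
qed (simp add: enn_powr_def)

lemma enn_powr_powr: "enn_powr (enn_powr x r) t = enn_powr x (r * t)"
  by (cases x) (simp_all add: enn_powr_def powr_powr)

lemma enn_powr_one [simp]: "enn_powr x 1 = x"
  by (cases x) (simp_all add: enn_powr_def)

lemma enn_powr_cmult:
  assumes "0 < c"
  shows "enn_powr (ennreal c * x) r = ennreal (c powr r) * enn_powr x r"
  using assms
  by (cases x) (simp_all add: enn_powr_def ennreal_mult'[symmetric] powr_mult ennreal_mult_top)

lemma enn_powr_less_top_iff: "enn_powr x r < \<infinity> \<longleftrightarrow> x < \<infinity>"
  by (auto simp: enn_powr_def top.not_eq_extremum)

lemma enn_powr_le_iff:
  assumes "0 < p" "0 \<le> s"
  shows "enn_powr I (1 / p) \<le> ennreal s \<longleftrightarrow> I \<le> ennreal (s powr p)"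
    and "ennreal s \<le> enn_powr I (1 / p) \<longleftrightarrow> ennreal (s powr p) \<le> I"
proof -
  have *: "enn_powr (enn_powr I (1 / p)) p = I" "enn_powr (enn_powr (ennreal s) p) (1 / p) = ennreal s"
    using assms by (simp_all add: enn_powr_powr)
  have s: "enn_powr (ennreal s) p = ennreal (s powr p)"
    using assms by (simp add: enn_powr_ennreal)
  show "enn_powr I (1 / p) \<le> ennreal s \<longleftrightarrow> I \<le> ennreal (s powr p)"
    using enn_powr_mono[of "enn_powr I (1 / p)" "ennreal s" p]
      enn_powr_mono[of I "ennreal (s powr p)" "1 / p"] assms(1) *
    unfolding s by auto
  show "ennreal s \<le> enn_powr I (1 / p) \<longleftrightarrow> ennreal (s powr p) \<le> I"
    using enn_powr_mono[of "ennreal s" "enn_powr I (1 / p)" p]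
      enn_powr_mono[of "ennreal (s powr p)" I "1 / p"] assms(1) *
    unfolding s by auto
qed

section \<open>Lower bounds for approximation numbers\<close>

text \<open>
  The coefficients are attached to indices and not to vectors, so that a repeated vector counts as
  a dependence.  The finite set \<open>B\<close> is there because \<open>dim V\<close> is \<open>0\<close> when
  \<open>V\<close> is infinite-dimensional, which would make the bound on the dimension worthless.
\<close>

lemma not_independent_family:
  fixes g :: "'i \<Rightarrow> 'v :: real_vector"
  assumes S: "finite S" and V: "g ` S \<subseteq> V" and B: "finite B" "V \<subseteq> span B"
    and dim: "dim V < card S"
  shows "\<exists>c. (\<exists>i\<in>S. c i \<noteq> 0) \<and> (\<Sum>i\<in>S. c i *\<^sub>R g i) = 0"
proof (cases "inj_on g S")
  case True
  obtain D where D: "D \<subseteq> V" "independent D" "V \<subseteq> span D" "card D = dim V"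
    by (rule basis_exists)
  have "finite D"
    using independent_span_bound[OF B(1) D(2)] D(1) B(2) by auto
  then have "dependent (g ` S)"
    using independent_span_bound[OF \<open>finite D\<close>, of "g ` S"] D V dim card_image[OF True] by auto
  then obtain u where u: "\<exists>v\<in>g ` S. u v \<noteq> 0" "(\<Sum>v\<in>g ` S. u v *\<^sub>R v) = 0"
    using dependent_finite[of "g ` S"] S by auto
  then show ?thesis
    using True by (intro exI[of _ "u \<circ> g"]) (auto simp: sum.reindex)
next
  case False
  then obtain i j where ij: "i \<in> S" "j \<in> S" "i \<noteq> j" "g i = g j"
    by (auto simp: inj_on_def)
  have "(\<Sum>k\<in>S. ((if k = i then 1 else 0) - (if k = j then 1 else 0)) *\<^sub>R g k)
      = (\<Sum>k\<in>S. if k = i then g k else 0) - (\<Sum>k\<in>S. if k = j then g k else 0)"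
    by (simp add: sum_subtractf[symmetric] scaleR_diff_left if_distrib[of "\<lambda>c. c *\<^sub>R _"] cong: if_cong)
  also have "\<dots> = 0"
    using ij S by simp
  finally show ?thesis
    using ij by (intro exI[of _ "\<lambda>k. (if k = i then 1 else 0) - (if k = j then 1 else 0)"]) auto
qed

lemma ae_fun_cases: obtains f where "F = abs_ae_fun f"
  by (induction F rule: ae_fun.abs_induct) blast

lemma sum_abs_ae_fun:
  "(\<Sum>i\<in>S. c i *\<^sub>R abs_ae_fun (f i)) = abs_ae_fun (\<lambda>x. \<Sum>i\<in>S. c i * f i x)"
  by (induction S rule: infinite_finite_induct)
     (simp_all add: zero_ae_fun.abs_eq scaleR_ae_fun.abs_eq plus_ae_fun.abs_eq)

lemma Lp_norm_abs:
  "Lp_norm p (abs_ae_fun f) = enn_powr (\<integral>\<^sup>+x. ennreal (\<bar>f x\<bar> powr p) \<partial>half_line) (1 / p)"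
  by (rule Lp_norm.abs_eq)

lemma abs_mem_Lp_iff:
  "abs_ae_fun f \<in> Lp p \<longleftrightarrow>
     f \<in> borel_measurable half_line \<and> (\<integral>\<^sup>+x. ennreal (\<bar>f x\<bar> powr p) \<partial>half_line) < \<infinity>"
  unfolding Lp_def using enn_powr_less_top_iff by (auto simp: ae_measurable.abs_eq Lp_norm_abs)

lemma abs_add_powr_le:
  fixes x y p :: real
  assumes "0 \<le> p"
  shows "\<bar>x + y\<bar> powr p \<le> 2 powr p * (\<bar>x\<bar> powr p + \<bar>y\<bar> powr p)"
proof -
  have "\<bar>x + y\<bar> powr p \<le> (2 * max \<bar>x\<bar> \<bar>y\<bar>) powr p"
    using assms by (intro powr_mono2) auto
  also have "\<dots> = 2 powr p * max \<bar>x\<bar> \<bar>y\<bar> powr p"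
    by (simp add: powr_mult)
  also have "\<dots> \<le> 2 powr p * (\<bar>x\<bar> powr p + \<bar>y\<bar> powr p)"
    by (intro mult_left_mono) (auto simp: max_def)
  finally show ?thesis .
qed

text \<open>
  Only finiteness of the norm is at stake, so the crude pointwise bound
  \<open>abs_add_powr_le\<close> suffices for sums.
\<close>

lemma subspace_Lp:
  assumes "0 < p"
  shows "subspace (Lp p)"
proof (rule subspaceI)
  show "0 \<in> Lp p"
    unfolding zero_ae_fun.abs_eq abs_mem_Lp_iff using assms by simp
next
  fix F G assume F: "F \<in> Lp p" and G: "G \<in> Lp p"
  obtain f where f: "F = abs_ae_fun f"
    by (rule ae_fun_cases)
  obtain g where g: "G = abs_ae_fun g"
    by (rule ae_fun_cases)
  note fg = f g
  have [measurable]: "f \<in> borel_measurable half_line" "g \<in> borel_measurable half_line"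
    using F G by (simp_all add: fg abs_mem_Lp_iff)
  have "(\<integral>\<^sup>+x. ennreal (\<bar>f x + g x\<bar> powr p) \<partial>half_line)
      \<le> (\<integral>\<^sup>+x. ennreal (2 powr p) * (ennreal (\<bar>f x\<bar> powr p) + ennreal (\<bar>g x\<bar> powr p)) \<partial>half_line)"
    using assms abs_add_powr_le[of p]
    by (intro nn_integral_mono)
       (simp add: ennreal_plus[symmetric] ennreal_mult'[symmetric] ennreal_leI del: ennreal_plus)
  also have "\<dots> = ennreal (2 powr p) * ((\<integral>\<^sup>+x. ennreal (\<bar>f x\<bar> powr p) \<partial>half_line)
                              + (\<integral>\<^sup>+x. ennreal (\<bar>g x\<bar> powr p) \<partial>half_line))"
    by (simp add: nn_integral_cmult nn_integral_add)
  also have "\<dots> < \<infinity>"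
    using F G by (simp add: fg abs_mem_Lp_iff ennreal_mult_less_top)
  finally show "F + G \<in> Lp p"
    by (simp add: fg plus_ae_fun.abs_eq abs_mem_Lp_iff)
next
  fix c :: real and F assume F: "F \<in> Lp p"
  obtain f where f: "F = abs_ae_fun f"
    by (rule ae_fun_cases)
  have [measurable]: "f \<in> borel_measurable half_line"
    using F by (simp add: f abs_mem_Lp_iff)
  have "(\<integral>\<^sup>+x. ennreal (\<bar>c * f x\<bar> powr p) \<partial>half_line)
      = ennreal (\<bar>c\<bar> powr p) * (\<integral>\<^sup>+x. ennreal (\<bar>f x\<bar> powr p) \<partial>half_line)"
    by (subst nn_integral_cmult[symmetric]) (simp_all add: abs_mult powr_mult ennreal_mult')
  also have "\<dots> < \<infinity>"
    using F by (simp add: f abs_mem_Lp_iff ennreal_mult_less_top)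
  finally show "c *\<^sub>R F \<in> Lp p"
    by (simp add: f scaleR_ae_fun.abs_eq abs_mem_Lp_iff)
qed

lemma bounded_operator_sum:
  assumes "0 < p" and K: "bounded_operator p K" and F: "\<And>i. i \<in> S \<Longrightarrow> F i \<in> Lp p"
  shows "K (\<Sum>i\<in>S. c i *\<^sub>R F i) = (\<Sum>i\<in>S. c i *\<^sub>R K (F i))"
proof -
  have "K (0 *\<^sub>R 0) = 0 *\<^sub>R K 0"
    using K subspace_0[OF subspace_Lp[OF \<open>0 < p\<close>]] unfolding bounded_operator_def by blast
  then have K0: "K 0 = 0"
    by simp
  show ?thesis
    using F
  proof (induction S rule: infinite_finite_induct)
    case (insert i S)
    note sub = subspace_Lp[OF \<open>0 < p\<close>]
    have "K (\<Sum>i\<in>insert i S. c i *\<^sub>R F i) = K (c i *\<^sub>R F i + (\<Sum>i\<in>S. c i *\<^sub>R F i))"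
      using insert by simp
    also have "\<dots> = K (c i *\<^sub>R F i) + K (\<Sum>i\<in>S. c i *\<^sub>R F i)"
    proof -
      have "c i *\<^sub>R F i \<in> Lp p" "(\<Sum>i\<in>S. c i *\<^sub>R F i) \<in> Lp p"
        using insert.prems by (auto intro!: subspace_scale[OF sub] subspace_sum[OF sub])
      then show ?thesis
        using K unfolding bounded_operator_def by blast
    qed
    also have "K (c i *\<^sub>R F i) = c i *\<^sub>R K (F i)"
      using K insert.prems unfolding bounded_operator_def by auto
    finally show ?case
      using insert by simp
  qed (simp_all add: K0)
qed

text \<open>
  A Bernstein-type lower bound.  Coefficients on \<open>S\<close> carry the \<open>\<ell>\<^sup>p\<close> norm: combining
  the \<open>F i\<close> does not increase it, and applying \<open>T\<close> afterwards leaves at least its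
  \<open>s\<close>-fold.  An operator of rank below \<open>card S\<close> annihilates some unit vector of coefficients, and at the
  corresponding element the difference \<open>T - K\<close> coincides with \<open>T\<close>.
\<close>

lemma approx_number_ge:
  fixes s :: ennreal
  assumes "0 < p" and "finite S" and F: "\<And>i. i \<in> S \<Longrightarrow> F i \<in> Lp p"
    and upper: "\<And>c. (\<Sum>i\<in>S. \<bar>c i\<bar> powr p) = 1 \<Longrightarrow> Lp_norm p (\<Sum>i\<in>S. c i *\<^sub>R F i) \<le> 1"
    and lower: "\<And>c. (\<Sum>i\<in>S. \<bar>c i\<bar> powr p) = 1 \<Longrightarrow> s \<le> Lp_norm p (T (\<Sum>i\<in>S. c i *\<^sub>R F i))"
  shows "s \<le> approx_number p T (card S)"
  unfolding approx_number_def
proof (rule INF_greatest, clarify)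
  fix K assume K: "bounded_operator p K" and "rank_less p K (card S)"
  then obtain B where "finite B" "K ` Lp p \<subseteq> span B" "dim (K ` Lp p) < card S"
    by (auto simp: rank_less_def)
  with F obtain c0 where c0: "\<exists>i\<in>S. c0 i \<noteq> 0" "(\<Sum>i\<in>S. c0 i *\<^sub>R K (F i)) = 0"
    using not_independent_family[OF \<open>finite S\<close>, of "\<lambda>i. K (F i)" "K ` Lp p" B] by auto
  define N where "N = (\<Sum>i\<in>S. \<bar>c0 i\<bar> powr p)"
  have "0 < N"
  proof -
    obtain i where "i \<in> S" "c0 i \<noteq> 0"
      using c0(1) by blast
    then show ?thesis
      unfolding N_def by (intro sum_pos2[OF \<open>finite S\<close>, of i]) auto
  qed
  define c where "c i = c0 i / N powr (1 / p)" for i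
  have "(\<Sum>i\<in>S. \<bar>c i\<bar> powr p) = (\<Sum>i\<in>S. \<bar>c0 i\<bar> powr p / N)"
    using \<open>0 < N\<close> \<open>0 < p\<close> by (simp add: c_def powr_divide powr_powr abs_divide)
  also have "\<dots> = 1"
    using \<open>0 < N\<close> by (simp add: sum_divide_distrib[symmetric] N_def)
  finally have c: "(\<Sum>i\<in>S. \<bar>c i\<bar> powr p) = 1" .
  define G where "G = (\<Sum>i\<in>S. c i *\<^sub>R F i)"
  have "K G = (\<Sum>i\<in>S. c i *\<^sub>R K (F i))"
    unfolding G_def using F by (intro bounded_operator_sum[OF \<open>0 < p\<close> K])
  also have "\<dots> = (1 / N powr (1 / p)) *\<^sub>R (\<Sum>i\<in>S. c0 i *\<^sub>R K (F i))"
    by (simp add: scaleR_right.sum c_def)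
  finally have "K G = 0"
    using c0 by simp
  have "G \<in> Lp p"
    unfolding G_def using F subspace_Lp[OF \<open>0 < p\<close>] by (intro subspace_sum subspace_scale) auto
  moreover have "Lp_norm p G \<le> 1"
    unfolding G_def by (rule upper[OF c])
  ultimately have "Lp_norm p (T G - K G) \<le> operator_norm p (\<lambda>F. T F - K F)"
    unfolding operator_norm_def by (intro SUP_upper) auto
  with lower[OF c] \<open>K G = 0\<close> show "s \<le> operator_norm p (\<lambda>F. T F - K F)"
    by (simp add: G_def)
qed

section \<open>Boundary functions and the sequence \<open>\<xi>\<close>\<close>

lemma bij_betw_half_line:
  fixes f :: "real \<Rightarrow> real"
  assumes cont: "continuous_on {0<..} f" and mono: "strict_mono_on {0<..} f"
    and lim0: "(f \<longlongrightarrow> 0) (at_right 0)" and top: "filterlim f at_top at_top"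
  shows "bij_betw f {0<..} {0<..}"
proof -
  have pos: "0 < f x" if "0 < x" for x
  proof -
    have "\<forall>\<^sub>F y in at_right 0. f y \<le> f (x/2)"
      using eventually_at_right_less[of 0] eventually_at_right[of 0 "x/2", THEN iffD2]
      unfolding eventually_at_right[OF \<open>0 < x\<close>]
      using that strict_mono_on_leD[OF mono]
      by (intro exI[of _ "x/2"]) auto
    then have "0 \<le> f (x/2)"
      by (rule tendsto_upperbound[OF lim0]) simp
    also have "f (x/2) < f x"
      using that by (intro strict_mono_onD[OF mono]) auto
    finally show ?thesis .
  qed
  have surj: "\<exists>x>0. f x = y" if "0 < y" for y
  proof -
    have "\<forall>\<^sub>F x in at_right 0. f x < y"
      using order_tendstoD(2)[OF lim0 that] .
    then obtain c where c: "0 < c" "\<And>x. 0 < x \<Longrightarrow> x < c \<Longrightarrow> f x < y"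
      unfolding eventually_at_right[OF zero_less_one] by auto
    obtain d0 where "\<And>x. d0 \<le> x \<Longrightarrow> y \<le> f x"
      using top unfolding filterlim_at_top eventually_at_top_linorder by blast
    then have d: "c < max d0 (c + 1)" "y \<le> f (max d0 (c + 1))"
      by auto
    have "\<exists>x\<ge>c/2. x \<le> max d0 (c + 1) \<and> f x = y"
    proof (rule IVT')
      show "f (c / 2) \<le> y"
        using c(1) by (intro less_imp_le c(2)) auto
      show "continuous_on {c / 2..max d0 (c + 1)} f"
        using c(1) by (intro continuous_on_subset[OF cont]) auto
    qed (use c(1) d in auto)
    then obtain x where "c / 2 \<le> x" "f x = y"
      by auto
    then show ?thesis
      using c(1) by (intro exI[of _ x]) auto
  qed
  show ?thesis
    unfolding bij_betw_def using pos surj strict_mono_on_imp_inj_on[OF mono] by force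
qed

lemma boundary_functions_continuous:
  assumes "boundary_functions a b"
  shows "continuous_on {0<..} a" "continuous_on {0<..} b"
  using assms by (auto simp: boundary_functions_def intro: differentiable_imp_continuous_on)

lemma boundary_functions_bij:
  assumes "boundary_functions a b"
  shows "bij_betw a {0<..} {0<..}" "bij_betw b {0<..} {0<..}"
  using assms boundary_functions_continuous[OF assms]
  by (auto simp: boundary_functions_def intro: bij_betw_half_line)

lemma pos_inv:
  assumes "bij_betw f {0<..} {0<..}" "0 < y"
  shows pos_inv_pos: "0 < pos_inv f y" and pos_inv_right: "f (pos_inv f y) = y"
  using assms f_the_inv_into_f_bij_betw[OF assms(1)]
    bij_betwE[OF bij_betw_the_inv_into[OF assms(1)]] by auto

text \<open>
  The recursion \<open>a(\<xi>\<^bsub>k+1\<^esub>) = b(\<xi>\<^bsub>k\<^esub>)\<close> holds on both sides of the case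
  distinction in the definition of the sequence: for negative indices one applies the map
  \<open>a\<^sup>-\<^sup>1 \<circ> b\<close>, a bijection of the open half-line, to its own inverse.
\<close>

lemma xi_step:
  assumes ab: "boundary_functions a b"
  shows xi_pos: "0 < xi a b k" and a_xi: "a (xi a b (k + 1)) = b (xi a b k)"
proof -
  note bij = boundary_functions_bij[OF ab]
  define g where "g = pos_inv a \<circ> b"
  have g: "bij_betw g {0<..} {0<..}"
    unfolding g_def using bij by (intro bij_betw_trans bij_betw_the_inv_into)
  have xi: "xi a b k = (if 0 \<le> k then (g ^^ nat k) 1 else (pos_inv g ^^ nat (- k)) 1)" for k
    by (simp add: xi_def g_def)
  have pos_funpow: "0 < (h ^^ n) 1" if "bij_betw h {0<..} {0<..}" for h :: "real \<Rightarrow> real" and n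
    using bij_betwE[OF that] by (induction n) auto
  have pos: "0 < xi a b k" for k
    using pos_funpow[OF g] pos_funpow[OF bij_betw_the_inv_into[OF g]] by (simp add: xi)
  have step: "xi a b (k + 1) = g (xi a b k)"
  proof (cases "0 \<le> k")
    case True
    then show ?thesis
      by (simp add: xi nat_add_distrib)
  next
    case False
    then obtain n where n: "k = - int (Suc n)"
      by (metis int_cases of_nat_0_le_iff)
    then have "xi a b k = pos_inv g (xi a b (k + 1))"
      by (cases n) (simp_all add: xi nat_add_distrib)
    then show ?thesis
      using pos_inv_right[OF g pos[of "k + 1"]] by simp
  qed
  show "0 < xi a b k"
    by (rule pos)
  have "0 < b (xi a b k)"
    using bij_betwE[OF bij(2)] pos[of k] by auto
  then show "a (xi a b (k + 1)) = b (xi a b k)"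
    by (simp add: step g_def pos_inv_right[OF bij(1)])
qed

lemma xi_strict_mono:
  assumes ab: "boundary_functions a b" and "j < k"
  shows "xi a b j < xi a b k"
proof -
  have succ: "xi a b k < xi a b (k + 1)" for k
  proof (rule ccontr)
    assume "\<not> ?thesis"
    then have "a (xi a b (k + 1)) \<le> a (xi a b k)"
      using ab xi_pos[OF ab] by (auto simp: boundary_functions_def intro: strict_mono_on_leD)
    with a_xi[OF ab, of k] xi_pos[OF ab, of k] ab show False
      by (auto simp: boundary_functions_def dest!: spec[of _ "xi a b k"])
  qed
  show ?thesis
    using \<open>j < k\<close>
  proof (induction k rule: int_gr_induct)
    case (step i)
    then show ?case
      using succ[of i] by linarith
  qed (rule succ)
qed

text \<open>
  For \<open>t\<close> between \<open>\<xi>\<^bsub>k\<^esub>\<close> and \<open>\<xi>\<^bsub>k+1\<^esub>\<close> the fairway value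
  \<open>\<sigma> t\<close> lies strictly between \<open>a(\<xi>\<^bsub>k\<^esub>) = b(\<xi>\<^bsub>k-1\<^esub>)\<close> and
  \<open>b(\<xi>\<^bsub>k+1\<^esub>) = a(\<xi>\<^bsub>k+2\<^esub>)\<close>; hence the interval over which \<open>w\<^sup>p\<close> is integrated stays
  inside \<open>(\<xi>\<^bsub>k-1\<^esub>, \<xi>\<^bsub>k+2\<^esub>)\<close>.
\<close>

lemma nu_localized:
  assumes ab: "boundary_functions a b" and \<sigma>: "fairway p v a b \<sigma>"
  shows "nu p v (\<lambda>x. indicator {xi a b (k - 1)<..<xi a b (k + 2)} x * w x) a b \<sigma> k
       = nu p v w a b \<sigma> k"
proof -
  note bij = boundary_functions_bij[OF ab]
  note pos = xi_pos[OF ab]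
  have mono: "strict_mono_on {0<..} a" "strict_mono_on {0<..} b"
    using ab by (auto simp: boundary_functions_def)
  have window: "xi a b (k - 1) < x \<and> x < xi a b (k + 2)"
    if t: "xi a b k < t" "t < xi a b (k + 1)"
      and x: "pos_inv b (\<sigma> t) \<le> x" "x \<le> pos_inv a (\<sigma> t)" for t x
  proof -
    have "0 < t"
      using t(1) pos[of k] by linarith
    with \<sigma> have \<sigma>t: "a t < \<sigma> t" "\<sigma> t < b t"
      by (auto simp: fairway_def)
    moreover have "0 < a t"
      using bij_betwE[OF bij(1)] \<open>0 < t\<close> by auto
    ultimately have "0 < \<sigma> t"
      by linarith
    note inv = pos_inv_pos[OF bij(1) this] pos_inv_right[OF bij(1) this]
      pos_inv_pos[OF bij(2) this] pos_inv_right[OF bij(2) this]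
    have "b (xi a b (k - 1)) = a (xi a b k)"
      using a_xi[OF ab, of "k - 1"] by simp
    also have "\<dots> < a t"
      using t pos[of k] \<open>0 < t\<close> by (intro strict_mono_onD[OF mono(1)]) auto
    finally have "b (xi a b (k - 1)) < b (pos_inv b (\<sigma> t))"
      using \<sigma>t inv by simp
    then have 1: "xi a b (k - 1) < pos_inv b (\<sigma> t)"
      using strict_mono_on_less[OF mono(2), of "xi a b (k - 1)" "pos_inv b (\<sigma> t)"]
        pos[of "k - 1"] inv by simp
    have "b t < b (xi a b (k + 1))"
      using t pos[of "k + 1"] \<open>0 < t\<close> by (intro strict_mono_onD[OF mono(2)]) auto
    also have "\<dots> = a (xi a b (k + 2))"
      using a_xi[OF ab, of "k + 1"] by (simp add: add.assoc)
    finally have "a (pos_inv a (\<sigma> t)) < a (xi a b (k + 2))"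
      using \<sigma>t inv by simp
    then have "pos_inv a (\<sigma> t) < xi a b (k + 2)"
      using strict_mono_on_less[OF mono(1), of "pos_inv a (\<sigma> t)" "xi a b (k + 2)"]
        pos[of "k + 2"] inv by simp
    with 1 x show ?thesis
      by linarith
  qed
  have "power_mass p (\<lambda>x. indicator {xi a b (k - 1)<..<xi a b (k + 2)} x * w x)
        (pos_inv b (\<sigma> t)) (pos_inv a (\<sigma> t))
      = power_mass p w (pos_inv b (\<sigma> t)) (pos_inv a (\<sigma> t))"
    if "t \<in> {xi a b k<..<xi a b (k + 1)}" for t
    unfolding power_mass_def
    using that window[of t] by (intro nn_integral_cong) (auto simp: indicator_def)
  then show ?thesis
    unfolding nu_def by (intro SUP_cong refl) simp
qed

section \<open>The Hardy-Steklov operator on independent windows\<close>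

text \<open>
  The weights and boundary functions are controlled on the open half-line only, whereas the
  function spaces live on the closed one; the endpoint is a null set.
\<close>

lemma half_line_measurable_interior:
  fixes u :: "real \<Rightarrow> real"
  assumes "u \<in> borel_measurable (lebesgue_on {0<..})"
  shows "u \<in> borel_measurable half_line"
proof (rule half_line_measurable_AE)
  have "(\<lambda>x. if x \<in> {0<..} then u x else 0) \<in> borel_measurable lebesgue"
    using assms by (subst borel_measurable_if) simp_all
  then show "(\<lambda>x. if x \<in> {0<..} then u x else 0) \<in> borel_measurable half_line"
    by (rule measurable_restrict_space1)
  have "AE x in lebesgue. x \<noteq> (0::real)"
    by (intro AE_completion AE_lborel_singleton)
  then show "AE x in half_line. (if x \<in> {0<..} then u x else 0) = u x"
    by (subst AE_restrict_space_iff) auto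
qed

lemma borel_measurable_half_line_id [measurable]: "(\<lambda>x. x) \<in> borel_measurable half_line"
  by (intro measurable_restrict_space1 measurable_completion) simp

lemma sigma_finite_lebesgue: "sigma_finite_measure (lebesgue :: 'a::euclidean_space measure)"
proof
  obtain A :: "'a set set" where A: "countable A" "A \<subseteq> sets lborel" "\<Union>A = space lborel"
      "\<forall>a\<in>A. emeasure lborel a \<noteq> \<infinity>"
    using lborel.sigma_finite_countable by blast
  then show "\<exists>A::'a set set. countable A \<and> A \<subseteq> sets lebesgue \<and> \<Union>A = space lebesgue \<and>
      (\<forall>a\<in>A. emeasure lebesgue a \<noteq> \<infinity>)"
    by (intro exI[of _ A]) auto
qed

text \<open>
  For a merely measurable \<open>f\<close> the product \<open>f v\<close> may fail to be integrable over
  some of the intervals \<open>[a(x), b(x)]\<close>, so continuity in \<open>x\<close> is not available.  The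
  argument goes through the joint measurability of the integrand in \<open>(x, y)\<close> instead.
\<close>

lemma hardy_steklov_measurable:
  assumes vw: "weights p v w" and ab: "boundary_functions a b"
    and f [measurable]: "f \<in> borel_measurable half_line"
  shows "(\<lambda>x. w x * (LINT y:{a x..b x}|half_line. f y * v y)) \<in> borel_measurable half_line"
proof -
  have [measurable]: "v \<in> borel_measurable half_line" "w \<in> borel_measurable half_line"
    using vw by (auto simp: weights_def Lp_loc_def intro: half_line_measurable_interior)
  have [measurable]: "a \<in> borel_measurable half_line" "b \<in> borel_measurable half_line"
    using boundary_functions_continuous[OF ab]
    by (auto intro!: half_line_measurable_interior continuous_imp_measurable_on_sets_lebesgue)
  interpret sigma_finite_measure half_line
    by (intro sigma_finite_measure_restrict_space sigma_finite_lebesgue) simp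
  have "(\<lambda>x. LINT y|half_line. (if a x \<le> y \<and> y \<le> b x then f y * v y else 0))
      \<in> borel_measurable half_line"
    by measurable
  moreover have "(LINT y:{a x..b x}|half_line. f y * v y)
      = (LINT y|half_line. (if a x \<le> y \<and> y \<le> b x then f y * v y else 0))" for x
    unfolding set_lebesgue_integral_def by (intro Bochner_Integration.integral_cong) auto
  ultimately show ?thesis
    by simp
qed

lemma borel_measurable_indicator_interval:
  "(indicator {c<..<d} :: real \<Rightarrow> real) \<in> borel_measurable (lebesgue_on X)"
  by (intro measurable_restrict_space1 borel_measurable_indicator) simp

lemma weights_indicator:
  assumes "weights p v w"
  shows "weights p v (\<lambda>x. indicator {c<..<d} x * w x)"
proof -
  have "(\<lambda>x. indicator {c<..<d} x * w x) \<in> borel_measurable (lebesgue_on {0<..})"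
    using assms unfolding weights_def Lp_loc_def
    by (intro borel_measurable_times borel_measurable_indicator_interval) auto
  moreover have "(\<integral>\<^sup>+x\<in>C. ennreal (\<bar>indicator {c<..<d} x * w x\<bar> powr p) \<partial>lebesgue) < \<infinity>"
    if "compact C" "C \<subseteq> {0<..}" for C
  proof -
    have "(\<integral>\<^sup>+x\<in>C. ennreal (\<bar>indicator {c<..<d} x * w x\<bar> powr p) \<partial>lebesgue)
        \<le> (\<integral>\<^sup>+x\<in>C. ennreal (\<bar>w x\<bar> powr p) \<partial>lebesgue)"
      by (intro nn_integral_mono) (auto simp: indicator_def)
    also have "\<dots> < \<infinity>"
      using assms that unfolding weights_def Lp_loc_def by blast
    finally show ?thesis .
  qed
  ultimately show ?thesis
    using assms unfolding weights_def Lp_loc_def by simp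
qed

lemma sum_eq_single:
  fixes h :: "'i \<Rightarrow> 'b::comm_monoid_add"
  assumes "finite S" "k \<in> S" "\<And>i. i \<in> S \<Longrightarrow> i \<noteq> k \<Longrightarrow> h i = 0"
  shows "sum h S = h k"
  using assms by (subst sum.mono_neutral_right[of S "{k}"]) auto

text \<open>
  The output of the operator on the window \<open>(c k, d k)\<close> depends only on the input on
  \<open>(a (c k), b (d k))\<close>.  If these input intervals are disjoint for different \<open>k\<close>, then so
  are the windows, and near-extremal functions for the windowed operators, cut off to the input
  intervals, do not interact: the \<open>p\<close>-th powers of the norms of a combination and of its image
  are bounded above and below, respectively, by sums over \<open>k\<close>.
\<close>

lemma approx_number_hardy_steklov_ge:
  fixes c d :: "'i \<Rightarrow> real"
  assumes p: "0 < p" and s: "0 \<le> s" and vw: "weights p v w" and ab: "boundary_functions a b"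
    and S: "finite S" and c: "\<And>k. k \<in> S \<Longrightarrow> 0 < c k"
    and disj: "disjoint_family_on (\<lambda>k. {a (c k)<..<b (d k)}) S"
    and norm: "\<And>k. k \<in> S \<Longrightarrow>
      ennreal s < operator_norm p (hardy_steklov v (\<lambda>x. indicator {c k<..<d k} x * w x) a b)"
  shows "ennreal s \<le> approx_number p (hardy_steklov v w a b) (card S)"
proof -
  define wk where "wk k x = indicator {c k<..<d k} x * w x" for k x
  have "\<exists>g. abs_ae_fun g \<in> Lp p \<and> Lp_norm p (abs_ae_fun g) \<le> 1 \<and>
      ennreal s \<le> Lp_norm p (hardy_steklov v (wk k) a b (abs_ae_fun g))" if k: "k \<in> S" for k
  proof -
    have "ennreal s < operator_norm p (hardy_steklov v (wk k) a b)"
      using norm[OF k] unfolding wk_def .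
    then obtain G where "G \<in> Lp p" "Lp_norm p G \<le> 1"
        "ennreal s < Lp_norm p (hardy_steklov v (wk k) a b G)"
      unfolding operator_norm_def less_SUP_iff by blast
    moreover obtain g where "G = abs_ae_fun g"
      by (rule ae_fun_cases)
    ultimately show ?thesis
      by (auto intro: less_imp_le)
  qed
  then obtain g where g: "\<And>k. k \<in> S \<Longrightarrow> abs_ae_fun (g k) \<in> Lp p"
      "\<And>k. k \<in> S \<Longrightarrow> Lp_norm p (abs_ae_fun (g k)) \<le> 1"
      "\<And>k. k \<in> S \<Longrightarrow> ennreal s \<le> Lp_norm p (hardy_steklov v (wk k) a b (abs_ae_fun (g k)))"
    by metis
  have g_meas: "g k \<in> borel_measurable half_line" if "k \<in> S" for k
    using g(1)[OF that] by (simp add: abs_mem_Lp_iff)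
  have g_le: "(\<integral>\<^sup>+x. ennreal (\<bar>g k x\<bar> powr p) \<partial>half_line) \<le> 1" if "k \<in> S" for k
    using g(2)[OF that] enn_powr_le_iff(1)[OF p, of 1] by (simp add: Lp_norm_abs)
  define h where "h f x = (LINT y:{a x..b x}|half_line. f y * v y)" for f x
  define u where "u k x = wk k x * h (g k) x" for k x
  have u_meas: "u k \<in> borel_measurable half_line" if "k \<in> S" for k
    unfolding u_def h_def wk_def
    by (rule hardy_steklov_measurable[OF weights_indicator[OF vw] ab g_meas[OF that]])
  have u_ge: "ennreal (s powr p) \<le> (\<integral>\<^sup>+x. ennreal (\<bar>u k x\<bar> powr p) \<partial>half_line)" if "k \<in> S" for k
    using g(3)[OF that] enn_powr_le_iff(2)[OF p s]
    by (simp add: hardy_steklov.abs_eq Lp_norm_abs u_def h_def)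
  define f where "f k y = indicator {a (c k)<..<b (d k)} y * g k y" for k y
  have f_zero: "f j y = 0" if "k \<in> S" "j \<in> S" "j \<noteq> k" "y \<in> {a (c k)<..<b (d k)}" for j k y
  proof -
    have "y \<notin> {a (c j)<..<b (d j)}"
      using disjoint_family_onD[OF disj that(2,1,3)] that(4) by blast
    then show ?thesis
      by (simp add: f_def)
  qed
  have sum_f: "(\<Sum>i\<in>S. l i * f i y) = l k * g k y"
    if "k \<in> S" "y \<in> {a (c k)<..<b (d k)}" for l k y
  proof -
    have "(\<Sum>i\<in>S. l i * f i y) = l k * f k y"
      by (rule sum_eq_single[OF S that(1)]) (simp add: f_zero[OF that(1) _ _ that(2)])
    then show ?thesis
      using that(2) by (simp add: f_def)
  qed
  (* Inputs to window k lie strictly inside its input interval; so a point common to two windows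
     would make their input intervals meet. *)
  have range: "a x \<in> {a (c k)<..<b (d k)} \<and> b x \<in> {a (c k)<..<b (d k)}"
    if "k \<in> S" "x \<in> {c k<..<d k}" for k x
  proof -
    have mono: "strict_mono_on {0<..} a" "strict_mono_on {0<..} b" and less: "\<forall>x>0. a x < b x"
      using ab by (simp_all add: boundary_functions_def)
    have x: "0 < c k" "c k < x" "x < d k"
      using that c by auto
    then have "a (c k) < a x" "b x < b (d k)"
      by (auto intro: strict_mono_onD[OF mono(1)] strict_mono_onD[OF mono(2)])
    moreover have "a x < b x"
      using x less by auto
    ultimately show ?thesis
      by auto
  qed
  have f_mem: "abs_ae_fun (f k) \<in> Lp p" if k: "k \<in> S" for k
  proof -
    have "f k \<in> borel_measurable half_line"
      unfolding f_def
      by (intro borel_measurable_times borel_measurable_indicator_interval g_meas[OF k])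
    moreover have "(\<integral>\<^sup>+x. ennreal (\<bar>f k x\<bar> powr p) \<partial>half_line) < \<infinity>"
    proof -
      have "(\<integral>\<^sup>+x. ennreal (\<bar>f k x\<bar> powr p) \<partial>half_line)
          \<le> (\<integral>\<^sup>+x. ennreal (\<bar>g k x\<bar> powr p) \<partial>half_line)"
        by (intro nn_integral_mono) (auto simp: f_def indicator_def)
      also have "\<dots> \<le> 1"
        by (rule g_le[OF k])
      also have "\<dots> < \<infinity>"
        by simp
      finally show ?thesis .
    qed
    ultimately show ?thesis
      by (simp add: abs_mem_Lp_iff)
  qed
  have combination: "(\<integral>\<^sup>+x. (\<Sum>i\<in>S. ennreal (\<bar>l i\<bar> powr p) * ennreal (\<bar>r i x\<bar> powr p)) \<partial>half_line)
      = (\<Sum>i\<in>S. ennreal (\<bar>l i\<bar> powr p) * (\<integral>\<^sup>+x. ennreal (\<bar>r i x\<bar> powr p) \<partial>half_line))"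
    if r: "\<And>i. i \<in> S \<Longrightarrow> r i \<in> borel_measurable half_line" for l :: "'i \<Rightarrow> real" and r
  proof -
    have m: "(\<lambda>x. ennreal (\<bar>r i x\<bar> powr p)) \<in> borel_measurable half_line" if "i \<in> S" for i
      using r[OF that] by measurable
    have "(\<integral>\<^sup>+x. (\<Sum>i\<in>S. ennreal (\<bar>l i\<bar> powr p) * ennreal (\<bar>r i x\<bar> powr p)) \<partial>half_line)
        = (\<Sum>i\<in>S. \<integral>\<^sup>+x. ennreal (\<bar>l i\<bar> powr p) * ennreal (\<bar>r i x\<bar> powr p) \<partial>half_line)"
      by (intro nn_integral_sum borel_measurable_times_ennreal borel_measurable_const m)
    also have "\<dots> = (\<Sum>i\<in>S. ennreal (\<bar>l i\<bar> powr p) * (\<integral>\<^sup>+x. ennreal (\<bar>r i x\<bar> powr p) \<partial>half_line))"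
      by (intro sum.cong refl nn_integral_cmult m)
    finally show ?thesis .
  qed
  show ?thesis
  proof (rule approx_number_ge[OF p S f_mem])
    fix l :: "'i \<Rightarrow> real"
    assume l: "(\<Sum>i\<in>S. \<bar>l i\<bar> powr p) = 1"
    have "(\<integral>\<^sup>+y. ennreal (\<bar>\<Sum>i\<in>S. l i * f i y\<bar> powr p) \<partial>half_line)
        \<le> (\<integral>\<^sup>+y. (\<Sum>i\<in>S. ennreal (\<bar>l i\<bar> powr p) * ennreal (\<bar>g i y\<bar> powr p)) \<partial>half_line)"
    proof (rule nn_integral_mono)
      fix y
      show "ennreal (\<bar>\<Sum>i\<in>S. l i * f i y\<bar> powr p)
          \<le> (\<Sum>i\<in>S. ennreal (\<bar>l i\<bar> powr p) * ennreal (\<bar>g i y\<bar> powr p))"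
      proof (cases "\<exists>k\<in>S. y \<in> {a (c k)<..<b (d k)}")
        case True
        then obtain k where k: "k \<in> S" "y \<in> {a (c k)<..<b (d k)}"
          by blast
        have "ennreal (\<bar>\<Sum>i\<in>S. l i * f i y\<bar> powr p) = ennreal (\<bar>l k\<bar> powr p) * ennreal (\<bar>g k y\<bar> powr p)"
          by (simp add: sum_f[OF k] abs_mult powr_mult ennreal_mult')
        also have "\<dots> \<le> (\<Sum>i\<in>S. ennreal (\<bar>l i\<bar> powr p) * ennreal (\<bar>g i y\<bar> powr p))"
          using k S by (intro member_le_sum) auto
        finally show ?thesis .
      next
        case False
        then have "(\<Sum>i\<in>S. l i * f i y) = 0"
          by (intro sum.neutral) (auto simp: f_def)
        then show ?thesis
          by simp
      qed
    qed
    also have "\<dots> = (\<Sum>i\<in>S. ennreal (\<bar>l i\<bar> powr p) * (\<integral>\<^sup>+y. ennreal (\<bar>g i y\<bar> powr p) \<partial>half_line))"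
      using g_meas by (simp add: combination)
    also have "\<dots> \<le> (\<Sum>i\<in>S. ennreal (\<bar>l i\<bar> powr p) * 1)"
      by (intro sum_mono mult_left_mono g_le) auto
    also have "\<dots> = 1"
      using l by (simp add: sum_ennreal)
    finally show "Lp_norm p (\<Sum>i\<in>S. l i *\<^sub>R abs_ae_fun (f i)) \<le> 1"
      using enn_powr_le_iff(1)[OF p, of 1] by (simp add: sum_abs_ae_fun Lp_norm_abs)

    have "ennreal (s powr p) = (\<Sum>i\<in>S. ennreal (\<bar>l i\<bar> powr p)) * ennreal (s powr p)"
      using l by (simp add: sum_ennreal)
    also have "\<dots> \<le> (\<Sum>i\<in>S. ennreal (\<bar>l i\<bar> powr p) * (\<integral>\<^sup>+x. ennreal (\<bar>u i x\<bar> powr p) \<partial>half_line))"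
      unfolding sum_distrib_right by (intro sum_mono mult_left_mono u_ge) auto
    also have "\<dots> = (\<integral>\<^sup>+x. (\<Sum>i\<in>S. ennreal (\<bar>l i\<bar> powr p) * ennreal (\<bar>u i x\<bar> powr p)) \<partial>half_line)"
      using u_meas by (simp add: combination)
    also have "\<dots> \<le> (\<integral>\<^sup>+x. ennreal (\<bar>w x * h (\<lambda>y. \<Sum>i\<in>S. l i * f i y) x\<bar> powr p) \<partial>half_line)"
    proof (rule nn_integral_mono)
      fix x
      show "(\<Sum>i\<in>S. ennreal (\<bar>l i\<bar> powr p) * ennreal (\<bar>u i x\<bar> powr p))
          \<le> ennreal (\<bar>w x * h (\<lambda>y. \<Sum>i\<in>S. l i * f i y) x\<bar> powr p)"
      proof (cases "\<exists>k\<in>S. x \<in> {c k<..<d k}")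
        case True
        then obtain k where k: "k \<in> S" "x \<in> {c k<..<d k}"
          by blast
        have u_zero: "u j x = 0" if j: "j \<in> S" "j \<noteq> k" for j
        proof -
          have "x \<notin> {c j<..<d j}"
            using disjoint_family_onD[OF disj j(1) k(1) j(2)] range[OF k] range[OF j(1), of x]
            by blast
          then show ?thesis
            by (simp add: u_def wk_def)
        qed
        have "h (\<lambda>y. \<Sum>i\<in>S. l i * f i y) x = h (\<lambda>y. l k * g k y) x"
          unfolding h_def set_lebesgue_integral_def
          using range[OF k] by (intro Bochner_Integration.integral_cong)
            (auto simp: indicator_def sum_f[OF k(1)])
        also have "\<dots> = l k * h (g k) x"
          by (simp add: h_def mult.assoc)
        finally have "w x * h (\<lambda>y. \<Sum>i\<in>S. l i * f i y) x = l k * u k x"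
          using k by (simp add: u_def wk_def)
        moreover have "(\<Sum>i\<in>S. ennreal (\<bar>l i\<bar> powr p) * ennreal (\<bar>u i x\<bar> powr p))
            = ennreal (\<bar>l k\<bar> powr p) * ennreal (\<bar>u k x\<bar> powr p)"
          by (intro sum_eq_single[OF S k(1)]) (simp add: u_zero)
        ultimately show ?thesis
          by (simp add: abs_mult powr_mult ennreal_mult')
      next
        case False
        then have "(\<Sum>i\<in>S. ennreal (\<bar>l i\<bar> powr p) * ennreal (\<bar>u i x\<bar> powr p)) = 0"
          by (intro sum.neutral) (auto simp: u_def wk_def)
        then show ?thesis
          by simp
      qed
    qed
    finally show "ennreal s \<le> Lp_norm p (hardy_steklov v w a b (\<Sum>i\<in>S. l i *\<^sub>R abs_ae_fun (f i)))"
      using enn_powr_le_iff(2)[OF p s]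
      by (simp add: sum_abs_ae_fun hardy_steklov.abs_eq Lp_norm_abs h_def)
  qed
qed

section \<open>Summation over the windows\<close>

text \<open>
  In a linear order the hypothesis says that the \<open>n\<close>-th largest value of \<open>f\<close> is at most
  \<open>A n\<close>.  Peeling off one bounded term at a time, starting from all of \<open>S\<close>, gives the
  inequality without rearranging \<open>f\<close>.
\<close>

lemma sum_le_sum_if_subset_min_le:
  fixes f :: "'i \<Rightarrow> 'b :: ordered_comm_monoid_add"
  assumes "finite S" and "\<And>T. T \<subseteq> S \<Longrightarrow> T \<noteq> {} \<Longrightarrow> \<exists>k\<in>T. f k \<le> A (card T)"
  shows "sum f S \<le> sum A {1..card S}"
  using assms
proof (induction "card S" arbitrary: S)
  case 0
  then show ?case
    by simp
next
  case (Suc n)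
  from Suc.hyps(2) have "S \<noteq> {}"
    by auto
  then obtain k where k: "k \<in> S" "f k \<le> A (card S)"
    using Suc.prems(2)[OF subset_refl] by metis
  have card: "card S = Suc (card (S - {k}))"
    using Suc.prems(1) k(1) by (rule card.remove)
  have IH: "sum f (S - {k}) \<le> sum A {1..card (S - {k})}"
  proof (rule Suc.hyps(1))
    show "n = card (S - {k})"
      using card Suc.hyps(2) by linarith
    show "finite (S - {k})"
      using Suc.prems(1) by simp
    show "\<exists>k\<in>T. f k \<le> A (card T)" if "T \<subseteq> S - {k}" "T \<noteq> {}" for T
      using that(1) by (intro Suc.prems(2) that(2)) blast
  qed
  have "sum f S = f k + sum f (S - {k})"
    by (rule sum.remove[OF Suc.prems(1) k(1)])
  also have "\<dots> \<le> A (card S) + sum A {1..card (S - {k})}"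
    by (rule add_mono[OF k(2) IH])
  also have "\<dots> = sum A {1..card S}"
    unfolding card by (simp add: add.commute)
  finally show ?case .
qed

theorem theorem2p8:
  fixes p \<alpha> \<beta> :: real and v w a b \<sigma> :: "real \<Rightarrow> real"
  assumes "1 < p"
    and "weights p v w"
    and "boundary_functions a b"
    and "fairway p v a b \<sigma>"
    and "lower_norm_constant p \<beta>"
    and "0 < \<alpha>"
  shows "(\<Sum>\<^sub>\<infinity>k. enn_powr (nu p v w a b \<sigma> k) \<alpha>)
    \<le> 28 * ennreal ((8 / \<beta>) powr \<alpha>) *
       (\<Sum>\<^sub>\<infinity>n\<in>{1..}. enn_powr (approx_number p (hardy_steklov v w a b) n) \<alpha>)"
proof -
  note ab = \<open>boundary_functions a b\<close>
  have \<beta>: "0 < \<beta>"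
    using assms(5) by (simp add: lower_norm_constant_def)
  define \<nu> where "\<nu> k = ennreal \<beta> * nu p v w a b \<sigma> k" for k
  define A where "A n = approx_number p (hardy_steklov v w a b) n" for n
  define Q where "Q = (\<Sum>\<^sub>\<infinity>n\<in>{1..}. enn_powr (A n) \<alpha>)"
  have Q: "sum (\<lambda>n. enn_powr (A n) \<alpha>) {1..n} \<le> Q" for n
    unfolding Q_def by (subst nonneg_infsum_complete) (auto intro!: SUP_upper)
  define c d where "c k = xi a b (k - 1)" and "d k = xi a b (k + 2)" for k
  have norm: "\<nu> k \<le> operator_norm p (hardy_steklov v (\<lambda>x. indicator {c k<..<d k} x * w x) a b)" for k
  proof -
    define wk where "wk x = indicator {c k<..<d k} x * w x" for x
    have "\<nu> k = ennreal \<beta> * nu p v wk a b \<sigma> k"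
      unfolding \<nu>_def wk_def c_def d_def by (simp add: nu_localized[OF ab assms(4)])
    also have "\<dots> \<le> ennreal \<beta> * (SUP k. nu p v wk a b \<sigma> k)"
      by (intro mult_left_mono SUP_upper) auto
    also have "\<dots> \<le> operator_norm p (hardy_steklov v wk a b)"
      using assms weights_indicator[OF assms(2), of "c k" "d k"]
      unfolding lower_norm_constant_def wk_def by blast
    finally show ?thesis
      unfolding wk_def .
  qed
  have separated: "b (d j) \<le> a (c k)" if "j + 4 \<le> k" for j k
  proof -
    have "b (d j) = a (xi a b (j + 3))"
      using a_xi[OF ab, of "j + 2"] by (simp add: d_def add.assoc)
    also have "\<dots> \<le> a (c k)"
    proof (cases "j + 4 = k")
      case False
      then show ?thesis
        using that ab xi_strict_mono[OF ab, of "j + 3" "k - 1"] xi_pos[OF ab]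
          strict_mono_on_leD[of "{0<..}" a "xi a b (j + 3)" "xi a b (k - 1)"]
        by (simp add: boundary_functions_def c_def)
    qed (auto simp: c_def add.commute)
    finally show ?thesis .
  qed
  have min_le: "\<exists>k\<in>T. \<nu> k \<le> A (card T)"
    if T: "finite T" "T \<noteq> {}" "\<And>k. k \<in> T \<Longrightarrow> k mod 4 = r" for T r
  proof (rule ccontr)
    assume "\<not> ?thesis"
    then have "A (card T) < Min (\<nu> ` T)"
      using T by (auto simp: not_le)
    (* The norm of a piece need not be attained and may be infinite: compare with a number
       strictly in between. *)
    then obtain t where t: "A (card T) < t" "t < Min (\<nu> ` T)"
      using dense by blast
    then obtain s where s: "t = ennreal s" "0 \<le> s"
      by (cases t) auto
    have "ennreal s \<le> A (card T)"
      unfolding A_def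
    proof (rule approx_number_hardy_steklov_ge[where c = c and d = d])
      show "disjoint_family_on (\<lambda>k. {a (c k)<..<b (d k)}) T"
        unfolding disjoint_family_on_def
      proof (intro ballI impI)
        fix j k assume "j \<in> T" "k \<in> T" "j \<noteq> k"
        then have "4 dvd k - j" "j \<noteq> k"
          using T(3) by (auto simp: mod_eq_dvd_iff[symmetric])
        then obtain m where "k - j = 4 * m" "m \<noteq> 0"
          by (auto elim: dvdE)
        then have "j + 4 \<le> k \<or> k + 4 \<le> j"
          by linarith
        then show "{a (c j)<..<b (d j)} \<inter> {a (c k)<..<b (d k)} = {}"
          using separated[of j k] separated[of k j] by auto
      qed
      show "ennreal s < operator_norm p (hardy_steklov v (\<lambda>x. indicator {c k<..<d k} x * w x) a b)"
        if "k \<in> T" for k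
        using t(2) T that norm[of k] by (auto simp: s)
    qed (use assms s T xi_pos[OF ab] in \<open>auto simp: c_def\<close>)
    with t(1) s show False
      by simp
  qed
  have class_sum: "(\<Sum>k\<in>{k\<in>F. k mod 4 = r}. enn_powr (\<nu> k) \<alpha>) \<le> Q" if F: "finite F" for F r
  proof -
    have "(\<Sum>k\<in>{k\<in>F. k mod 4 = r}. enn_powr (\<nu> k) \<alpha>)
        \<le> (\<Sum>n\<in>{1..card {k\<in>F. k mod 4 = r}}. enn_powr (A n) \<alpha>)"
    proof (rule sum_le_sum_if_subset_min_le)
      fix T assume T: "T \<subseteq> {k\<in>F. k mod 4 = r}" "T \<noteq> {}"
      then obtain k where "k \<in> T" "\<nu> k \<le> A (card T)"
        using min_le[of T r] finite_subset[OF T(1)] F by auto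
      then show "\<exists>k\<in>T. enn_powr (\<nu> k) \<alpha> \<le> enn_powr (A (card T)) \<alpha>"
        using \<open>0 < \<alpha>\<close> by (intro bexI[of _ k] enn_powr_mono) simp_all
    qed (use F in auto)
    then show ?thesis
      using Q by (rule order_trans)
  qed
  have \<nu>_powr: "enn_powr (nu p v w a b \<sigma> k) \<alpha> = ennreal ((1 / \<beta>) powr \<alpha>) * enn_powr (\<nu> k) \<alpha>" for k
  proof -
    have "ennreal (1 / \<beta>) * \<nu> k = nu p v w a b \<sigma> k"
      using \<beta> by (simp add: \<nu>_def mult.assoc[symmetric] ennreal_mult'[symmetric])
    then show ?thesis
      using \<beta> enn_powr_cmult[of "1 / \<beta>" "\<nu> k" \<alpha>] by simp
  qed
  have "(\<Sum>k\<in>F. enn_powr (nu p v w a b \<sigma> k) \<alpha>) \<le> 28 * ennreal ((8 / \<beta>) powr \<alpha>) * Q"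
    if F: "finite F" for F
  proof -
    have "(\<Sum>k\<in>F. enn_powr (\<nu> k) \<alpha>)
        = (\<Sum>r\<in>{0..<4}. \<Sum>k\<in>{k\<in>F. k mod 4 = r}. enn_powr (\<nu> k) \<alpha>)"
      using F by (intro sum.group[symmetric]) auto
    also have "\<dots> \<le> (\<Sum>r\<in>{0..<4::int}. Q)"
      by (intro sum_mono class_sum F)
    also have "\<dots> = 4 * Q"
      by simp
    finally have "(\<Sum>k\<in>F. enn_powr (nu p v w a b \<sigma> k) \<alpha>) \<le> ennreal ((1 / \<beta>) powr \<alpha>) * (4 * Q)"
      unfolding \<nu>_powr sum_distrib_left[symmetric] by (rule mult_left_mono) simp
    also have "\<dots> \<le> ennreal ((8 / \<beta>) powr \<alpha>) * (28 * Q)"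
      using \<beta> assms by (intro mult_mono ennreal_leI powr_mono2 divide_right_mono) auto
    finally show ?thesis
      by (simp add: mult_ac)
  qed
  then show ?thesis
    unfolding Q_def A_def by (subst nonneg_infsum_complete) (auto intro!: SUP_least)
qed

end
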